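(* Let $A$ be a finite abelian group and let $G \in \mathcal{G}$ be a group that acts on a full shift $\Sigma^{\mathbb{Z}}$ (for some finite alphabet $\Sigma$) by automorphisms without $A$-cancellation. Then the restricted wreath product $A \wr G$ belongs to $\mathcal{G}$.
   Context: For a finite alphabet $\Sigma$ with $|\Sigma|\ge 2$, $\mathrm{Aut}(\Sigma^{\mathbb{Z}})$ is the group of homeomorphisms of $\Sigma^{\mathbb{Z}}$ commuting with the shift $\sigma(x)_i = x_{i+1}$. $\mathcal{G}$ is the class of groups isomorphic to a subgroup of $\mathrm{Aut}(\Sigma^{\mathbb{Z}})$ (known not to depend on the choice of the finite alphabet $\Sigma$, $|\Sigma|\ge 2$). Acting by automorphisms means acting through a homomorphism $G\to \mathrm{Aut}(\Sigma^{\mathbb{Z}})$. A $G$-system $(G,X)$ is a zero-dimensional compact metrizable space $X$ with an action of the discrete group $G$ by homeomorphisms. Let $A$, $B$ be finite abelian groups and $\theta : X \to \mathrm{Hom}(A,B)$ continuous ($\mathrm{Hom}(A,B)$ discrete). $(G,X)$ has $A$-cancellation with respect to $(\theta,B)$ if there exists a finitely supported map $f : G\to A$, $f\neq 0$, such that $\sum_{g\in G}\theta(gx)(f(g)) = 0$ for all $x\in X$. $(G,X)$ has $A$-cancellation if it has $A$-cancellation with respect to every such $(\theta,B)$ (for all finite abelian $B$); otherwise it is without $A$-cancellation. $A\wr G = \left(\bigoplus_{G} A\right)\rtimes G$ is the restricted wreath product. *)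

theory Defs
  imports
    "HOL-Analysis.Analysis"
    "HOL-Algebra.Bij"
    "HOL-Algebra.Free_Abelian_Groups"
begin

section \<open>Systems\<close>

definition zero_dimensional_space :: "'x topology \<Rightarrow> bool" where
  "zero_dimensional_space X \<longleftrightarrow>
     neighbourhood_base_of (\<lambda>V. openin X V \<and> closedin X V) X"

text \<open>As in \<^const>\<open>BijGroup\<close>, self-maps are \<^const>\<open>extensional\<close>, so that two of them are equal
  as soon as they agree on the space.\<close>

definition homeo_group :: "'x topology \<Rightarrow> ('x \<Rightarrow> 'x) monoid" where
  "homeo_group X =
     BijGroup (topspace X)\<lparr>carrier := {f \<in> Bij (topspace X). homeomorphic_map X X f}\<rparr>"

definition G_system ::
  "('g, 'm) monoid_scheme \<Rightarrow> 'x topology \<Rightarrow> ('g \<Rightarrow> 'x \<Rightarrow> 'x) \<Rightarrow> bool" where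
  "G_system G X \<phi> \<longleftrightarrow>
     group G \<and> compact_space X \<and> metrizable_space X \<and> zero_dimensional_space X \<and>
     \<phi> \<in> hom G (homeo_group X)"


section \<open>Automorphisms of full shifts\<close>

definition alphabet :: "'s set \<Rightarrow> bool" where
  "alphabet S \<longleftrightarrow> finite S \<and> 2 \<le> card S"

definition full_shift :: "'s set \<Rightarrow> (int \<Rightarrow> 's) topology" where
  "full_shift S = product_topology (\<lambda>_. discrete_topology S) UNIV"

definition shift :: "(int \<Rightarrow> 's) \<Rightarrow> int \<Rightarrow> 's" where
  "shift x = (\<lambda>i. x (i + 1))"

definition shift_aut :: "'s set \<Rightarrow> ((int \<Rightarrow> 's) \<Rightarrow> (int \<Rightarrow> 's)) monoid" where
  "shift_aut S = homeo_group (full_shift S)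
     \<lparr>carrier := {f \<in> carrier (homeo_group (full_shift S)).
                   \<forall>x \<in> topspace (full_shift S). f (shift x) = shift (f x)}\<rparr>"

text \<open>Every finite alphabet is in bijection with a finite set of natural numbers, so nothing is
  lost by letting the alphabet range over sets of type \<^typ>\<open>nat set\<close> only.  That the class does
  not depend on the alphabet is a theorem of Kim and Roush, not built into the definition: a group
  belongs to the class if it embeds for some alphabet.\<close>

definition class_G :: "('g, 'm) monoid_scheme \<Rightarrow> bool" where
  "class_G G \<longleftrightarrow> group G \<and>
     (\<exists>(S :: nat set) H. alphabet S \<and> subgroup H (shift_aut S) \<and>
        G \<cong> shift_aut S\<lparr>carrier := H\<rparr>)"

lemma group_homeo_group: "group (homeo_group X)"
proof -
  interpret B: group "BijGroup (topspace X)" by (rule group_BijGroup)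
  let ?H = "{f \<in> Bij (topspace X). homeomorphic_map X X f}"
  have "subgroup ?H (BijGroup (topspace X))"
  proof (rule B.subgroupI)
    show "?H \<subseteq> carrier (BijGroup (topspace X))" by (auto simp: BijGroup_def)
    have "(\<lambda>x\<in>topspace X. x) \<in> ?H"
      using homeomorphic_map_eq[of X X id "\<lambda>x\<in>topspace X. x"] by (simp add: id_Bij)
    then show "?H \<noteq> {}" by blast
    show "inv\<^bsub>BijGroup (topspace X)\<^esub> f \<in> ?H" if "f \<in> ?H" for f
    proof -
      have f: "f \<in> Bij (topspace X)" "homeomorphic_map X X f" using that by auto
      then obtain g where g: "homeomorphic_maps X X f g" by (auto simp: homeomorphic_map_maps)
      let ?i = "\<lambda>x\<in>topspace X. inv_into (topspace X) f x"
      have "g x = ?i x" if "x \<in> topspace X" for x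
      proof -
        have "g x \<in> topspace X" "f (g x) = x"
          using g that unfolding homeomorphic_maps_def continuous_map_def by auto
        then show ?thesis
          using f(1) that by (auto simp: Bij_def bij_betw_def inv_into_f_eq)
      qed
      then have "homeomorphic_map X X ?i"
        using g homeomorphic_map_eq homeomorphic_maps_map by blast
      then show ?thesis using f(1) by (simp add: inv_BijGroup restrict_inv_into_Bij)
    qed
    show "f \<otimes>\<^bsub>BijGroup (topspace X)\<^esub> g \<in> ?H" if "f \<in> ?H" "g \<in> ?H" for f g
    proof -
      have "homeomorphic_map X X (compose (topspace X) f g)"
        using that homeomorphic_map_compose[of X X g X f]
        by (auto intro: homeomorphic_map_eq simp: compose_def)
      then show ?thesis using that by (simp add: BijGroup_def compose_Bij)
    qed
  qed
  then show ?thesis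
    unfolding homeo_group_def by (rule B.subgroup_imp_group)
qed

lemma topspace_full_shift: "topspace (full_shift S) = {x. \<forall>i. x i \<in> S}"
  by (auto simp: full_shift_def PiE_def Pi_def extensional_def)

lemma subgroup_shift_aut:
  "subgroup (carrier (shift_aut S)) (homeo_group (full_shift S))"
proof -
  let ?X = "full_shift S"
  interpret B: group "BijGroup (topspace ?X)" by (rule group_BijGroup)
  interpret H: group "homeo_group ?X" by (rule group_homeo_group)
  have sh: "shift x \<in> topspace ?X" if "x \<in> topspace ?X" for x
    using that by (simp add: topspace_full_shift shift_def)
  have C: "carrier (shift_aut S) = {f \<in> carrier (homeo_group ?X).
      \<forall>x\<in>topspace ?X. f (shift x) = shift (f x)}"
    by (simp add: shift_aut_def)
  have mult: "f \<otimes>\<^bsub>homeo_group ?X\<^esub> g = compose (topspace ?X) f g"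
    if "f \<in> carrier (homeo_group ?X)" "g \<in> carrier (homeo_group ?X)" for f g
    using that by (auto simp: homeo_group_def BijGroup_def)
  have one: "\<one>\<^bsub>homeo_group ?X\<^esub> = (\<lambda>x\<in>topspace ?X. x)"
    by (simp add: homeo_group_def BijGroup_def)
  have cl: "f x \<in> topspace ?X"
    if "f \<in> carrier (homeo_group ?X)" "x \<in> topspace ?X" for f x
    using that by (auto simp: homeo_group_def dest!: Bij_imp_funcset)
  show ?thesis
  proof (rule H.subgroupI)
    show "carrier (shift_aut S) \<subseteq> carrier (homeo_group ?X)" using C by auto
    have "\<one>\<^bsub>homeo_group ?X\<^esub> \<in> carrier (shift_aut S)"
      using sh H.one_closed unfolding C one by auto
    then show "carrier (shift_aut S) \<noteq> {}" by blast
    show "f \<otimes>\<^bsub>homeo_group ?X\<^esub> g \<in> carrier (shift_aut S)"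
      if "f \<in> carrier (shift_aut S)" "g \<in> carrier (shift_aut S)" for f g
    proof -
      have fg: "f \<in> carrier (homeo_group ?X)" "g \<in> carrier (homeo_group ?X)"
        using that C by auto
      have "(f \<otimes>\<^bsub>homeo_group ?X\<^esub> g) (shift x) = shift ((f \<otimes>\<^bsub>homeo_group ?X\<^esub> g) x)"
        if "x \<in> topspace ?X" for x
        using that sh cl fg \<open>f \<in> carrier (shift_aut S)\<close> \<open>g \<in> carrier (shift_aut S)\<close>
        by (simp add: C mult compose_def)
      then show ?thesis using fg by (simp add: C)
    qed
    show "inv\<^bsub>homeo_group ?X\<^esub> f \<in> carrier (shift_aut S)" if "f \<in> carrier (shift_aut S)" for f
    proof -
      let ?g = "inv\<^bsub>homeo_group ?X\<^esub> f"
      have f: "f \<in> carrier (homeo_group ?X)"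
        and fs: "\<And>x. x \<in> topspace ?X \<Longrightarrow> f (shift x) = shift (f x)"
        using that C by auto
      have g: "?g \<in> carrier (homeo_group ?X)" using f by simp
      have gf: "?g (f x) = x" if "x \<in> topspace ?X" for x
        using fun_cong[OF H.l_inv[OF f], of x] that f g
        by (simp add: mult one compose_def)
      have fg: "f (?g x) = x" if "x \<in> topspace ?X" for x
        using fun_cong[OF H.r_inv[OF f], of x] that f g
        by (simp add: mult one compose_def)
      have "?g (shift x) = shift (?g x)" if x: "x \<in> topspace ?X" for x
      proof -
        have "?g (shift x) = ?g (f (shift (?g x)))"
          using fs[of "?g x"] fg[OF x] cl[OF g x] by simp
        also have "\<dots> = shift (?g x)" using gf sh cl[OF g x] by simp
        finally show ?thesis .
      qed
      then show ?thesis using g by (simp add: C)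
    qed
  qed
qed

lemma group_shift_aut: "group (shift_aut S)"
proof -
  have "shift_aut S = homeo_group (full_shift S)\<lparr>carrier := carrier (shift_aut S)\<rparr>"
    by (simp add: shift_aut_def)
  then show ?thesis
    using group.subgroup_imp_group[OF group_homeo_group subgroup_shift_aut] by metis
qed

lemma zero_dimensional_full_shift: "zero_dimensional_space (full_shift S)"
  unfolding zero_dimensional_space_def neighbourhood_base_of
proof (intro allI impI)
  fix W x
  assume "openin (full_shift S) W \<and> x \<in> W"
  then obtain U where U: "finite {i. U i \<noteq> S}" "\<And>i. U i \<subseteq> S"
      "x \<in> Pi\<^sub>E UNIV U" "Pi\<^sub>E UNIV U \<subseteq> W"
    unfolding full_shift_def openin_product_topology_alt by auto
  have "openin (full_shift S) (Pi\<^sub>E UNIV U)"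
    using U unfolding full_shift_def by (auto simp: openin_PiE_gen)
  moreover have "closedin (full_shift S) (Pi\<^sub>E UNIV U)"
    using U(2) unfolding full_shift_def by (simp add: closedin_product_topology)
  ultimately show "\<exists>U V. openin (full_shift S) U \<and>
      (openin (full_shift S) V \<and> closedin (full_shift S) V) \<and> x \<in> U \<and> U \<subseteq> V \<and> V \<subseteq> W"
    using U by blast
qed

lemma G_system_shift_aut:
  assumes "group G" "alphabet S" "\<phi> \<in> hom G (shift_aut S)"
  shows "G_system G (full_shift S) \<phi>"
proof -
  have "compact_space (full_shift S)"
    using assms(2) by (simp add: full_shift_def alphabet_def compact_space_product_topology
        compact_space_discrete_topology)
  moreover have "metrizable_space (full_shift S)"
    by (simp add: full_shift_def metrizable_space_product_topology)
  moreover have "\<phi> \<in> hom G (homeo_group (full_shift S))"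
    using assms(3) by (auto simp: hom_def shift_aut_def)
  ultimately show ?thesis
    using assms(1) by (simp add: G_system_def zero_dimensional_full_shift)
qed


section \<open>Cancellation\<close>

text \<open>Groups are written multiplicatively, including the abelian groups \<open>A\<close> and \<open>B\<close>.
  Homomorphisms are restricted to be \<^const>\<open>extensional\<close>: only then is the set \<open>Hom A B\<close>
  finite for finite \<open>A\<close> and \<open>B\<close>, with no dependence on values outside of \<open>A\<close>.\<close>

definition Hom ::
  "('a, 'm) monoid_scheme \<Rightarrow> ('b, 'n) monoid_scheme \<Rightarrow> ('a \<Rightarrow> 'b) set" where
  "Hom A B = hom A B \<inter> extensional (carrier A)"

text \<open>The elements of \<^term>\<open>sum_group (carrier G) (\<lambda>_. A)\<close> are the finitely supported maps
  from \<open>G\<close> to \<open>A\<close>.  The product must be \<^const>\<open>gfinprod\<close>, which multiplies over the support,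
  as \<^const>\<open>finprod\<close> is constantly \<open>\<one>\<close> over an infinite set.\<close>

definition has_cancellation_wrt ::
  "('a, 'm) monoid_scheme \<Rightarrow> ('g, 'n) monoid_scheme \<Rightarrow> 'x topology \<Rightarrow> ('g \<Rightarrow> 'x \<Rightarrow> 'x) \<Rightarrow>
   ('x \<Rightarrow> 'a \<Rightarrow> 'b) \<Rightarrow> ('b, 'k) monoid_scheme \<Rightarrow> bool" where
  "has_cancellation_wrt A G X \<phi> \<theta> B \<longleftrightarrow>
     (\<exists>f \<in> carrier (sum_group (carrier G) (\<lambda>_. A)).
        f \<noteq> \<one>\<^bsub>sum_group (carrier G) (\<lambda>_. A)\<^esub> \<and>
        (\<forall>x \<in> topspace X. gfinprod B (\<lambda>g. \<theta> (\<phi> g x) (f g)) (carrier G) = \<one>\<^bsub>B\<^esub>))"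

text \<open>Here \<open>B\<close> ranges over the finite abelian groups whose elements are natural numbers; by the
  lemma below, this accounts for finite abelian groups of all types.\<close>

definition has_cancellation ::
  "('a, 'm) monoid_scheme \<Rightarrow> ('g, 'n) monoid_scheme \<Rightarrow> 'x topology \<Rightarrow> ('g \<Rightarrow> 'x \<Rightarrow> 'x) \<Rightarrow> bool" where
  "has_cancellation A G X \<phi> \<longleftrightarrow>
     (\<forall>(B :: nat monoid) \<theta>. comm_group B \<and> finite (carrier B) \<and>
        continuous_map X (discrete_topology (Hom A B)) \<theta> \<longrightarrow>
        has_cancellation_wrt A G X \<phi> \<theta> B)"

lemma has_cancellation_any_type:
  fixes B :: "('b, 'k) monoid_scheme"
  assumes A: "comm_group A" and G: "G_system G X \<phi>" and canc: "has_cancellation A G X \<phi>"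
    and B: "comm_group B" "finite (carrier B)"
    and \<theta>: "continuous_map X (discrete_topology (Hom A B)) \<theta>"
  shows "has_cancellation_wrt A G X \<phi> \<theta> B"
proof -
  interpret A: comm_group A by fact
  interpret B: comm_group B by fact
  obtain h :: "'b \<Rightarrow> nat" where h: "inj_on h (carrier B)"
    using finite_imp_inj_to_nat_seg[OF B(2)] by blast
  define k where "k = inv_into (carrier B) h"
  define C :: "nat monoid" where
    "C = \<lparr>carrier = h ` carrier B, monoid.mult = (\<lambda>x y. h (k x \<otimes>\<^bsub>B\<^esub> k y)), one = h \<one>\<^bsub>B\<^esub>\<rparr>"
  have kh [simp]: "k (h b) = b" if "b \<in> carrier B" for b
    using that h by (simp add: k_def)
  have oneC: "\<one>\<^bsub>C\<^esub> = h \<one>\<^bsub>B\<^esub>"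
    and multC: "\<And>x y. x \<otimes>\<^bsub>C\<^esub> y = h (k x \<otimes>\<^bsub>B\<^esub> k y)"
    by (simp_all add: C_def)
  have hiso: "h \<in> iso B C"
    using h by (auto simp: iso_def hom_def C_def bij_betw_def)
  have C: "comm_group C"
  proof -
    have "comm_group (C\<lparr>one := h \<one>\<^bsub>B\<^esub>\<rparr>)"
      by (rule B.iso_imp_img_comm_group[OF hiso])
    then show ?thesis by (simp add: C_def)
  qed
  interpret C: comm_group C by fact
  define \<theta>' where "\<theta>' = (\<lambda>x. \<lambda>a\<in>carrier A. h (\<theta> x a))"
  have \<theta>H: "\<theta> x \<in> hom A B" if "x \<in> topspace X" for x
    using continuous_map_image_subset_topspace[OF \<theta>] that by (auto simp: Hom_def)
  have "(\<lambda>p. \<lambda>a\<in>carrier A. h (p a)) \<in> Hom A B \<rightarrow> Hom A C"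
    using hiso by (auto simp: Hom_def hom_def iso_def Pi_def)
  then have "continuous_map (discrete_topology (Hom A B)) (discrete_topology (Hom A C))
      (\<lambda>p. \<lambda>a\<in>carrier A. h (p a))"
    by simp
  from continuous_map_compose[OF \<theta> this]
  have "continuous_map X (discrete_topology (Hom A C)) \<theta>'"
    by (simp add: o_def \<theta>'_def)
  moreover have "finite (carrier C)" using B(2) by (simp add: C_def)
  ultimately have "has_cancellation_wrt A G X \<phi> \<theta>' C"
    using canc C by (simp add: has_cancellation_def)
  then obtain f where f: "f \<in> carrier (sum_group (carrier G) (\<lambda>_. A))"
      "f \<noteq> \<one>\<^bsub>sum_group (carrier G) (\<lambda>_. A)\<^esub>"
      and eq: "\<And>x. x \<in> topspace X \<Longrightarrow>
        gfinprod C (\<lambda>g. \<theta>' (\<phi> g x) (f g)) (carrier G) = \<one>\<^bsub>C\<^esub>"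
    by (auto simp: has_cancellation_wrt_def)
  have fA: "f g \<in> carrier A" if "g \<in> carrier G" for g
    using f(1) that by (auto simp: carrier_sum_group)
  have "gfinprod B (\<lambda>g. \<theta> (\<phi> g x) (f g)) (carrier G) = \<one>\<^bsub>B\<^esub>" if x: "x \<in> topspace X" for x
  proof -
    have "\<phi> g x \<in> topspace X" if "g \<in> carrier G" for g
      using G that x by (auto simp: G_system_def hom_def homeo_group_def dest!: Bij_imp_funcset)
    then have cl: "\<theta> (\<phi> g x) (f g) \<in> carrier B" if "g \<in> carrier G" for g
      using \<theta>H fA that by (meson hom_in_carrier)
    let ?F = "\<lambda>g. \<theta> (\<phi> g x) (f g)"
    let ?s = "{g \<in> carrier G. ?F g \<noteq> \<one>\<^bsub>B\<^esub>}"
    have eqv: "\<theta>' (\<phi> g x) (f g) = h (?F g)" if "g \<in> carrier G" for g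
      using fA that by (simp add: \<theta>'_def)
    have supp: "{g \<in> carrier G. \<theta>' (\<phi> g x) (f g) \<noteq> \<one>\<^bsub>C\<^esub>} = ?s"
      using eqv cl by (auto simp: C_def inj_on_eq_iff[OF h])
    have fin: "finprod C (\<lambda>g. h (?F g)) T = h (finprod B ?F T)"
      if "finite T" "T \<subseteq> carrier G" for T
      using that
    proof (induction T rule: finite_induct)
      case empty
      show ?case by (simp add: oneC)
    next
      case (insert g T)
      have 1: "?F \<in> T \<rightarrow> carrier B" "?F g \<in> carrier B" using insert cl by auto
      have 2: "(\<lambda>g. h (?F g)) \<in> T \<rightarrow> carrier C" "h (?F g) \<in> carrier C"
        using 1 by (auto simp: C_def)
      show ?case
        using insert 1 2 B.finprod_closed[OF 1(1)]
        by (simp add: multC)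
    qed
    show ?thesis
    proof (cases "finite ?s")
      case True
      have "finprod C (\<lambda>g. \<theta>' (\<phi> g x) (f g)) ?s = finprod C (\<lambda>g. h (?F g)) ?s"
        by (rule C.finprod_cong') (use eqv cl in \<open>auto simp: C_def\<close>)
      then have "h (finprod B ?F ?s) = h \<one>\<^bsub>B\<^esub>"
        using eq[OF x, unfolded gfinprod_def supp] True fin[OF True] by (simp add: oneC)
      moreover have "finprod B ?F ?s \<in> carrier B"
        using cl by (intro B.finprod_closed) auto
      ultimately show ?thesis
        using True h by (auto simp: gfinprod_def dest: inj_onD)
    qed (simp add: gfinprod_def)
  qed
  then show ?thesis using f by (auto simp: has_cancellation_wrt_def)
qed


section \<open>Wreath products\<close>

definition semidirect_product ::
  "('n, 'k) monoid_scheme \<Rightarrow> ('h, 'm) monoid_scheme \<Rightarrow> ('h \<Rightarrow> 'n \<Rightarrow> 'n) \<Rightarrow> ('n \<times> 'h) monoid" where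
  "semidirect_product N H \<alpha> =
     \<lparr>carrier = carrier N \<times> carrier H,
      monoid.mult = (\<lambda>(n, h) (n', h'). (n \<otimes>\<^bsub>N\<^esub> \<alpha> h n', h \<otimes>\<^bsub>H\<^esub> h')),
      one = (\<one>\<^bsub>N\<^esub>, \<one>\<^bsub>H\<^esub>)\<rparr>"

definition wreath_product ::
  "('a, 'm) monoid_scheme \<Rightarrow> ('g, 'n) monoid_scheme \<Rightarrow> (('g \<Rightarrow> 'a) \<times> 'g) monoid" where
  "wreath_product A G =
     semidirect_product (sum_group (carrier G) (\<lambda>_. A)) G
       (\<lambda>g f. \<lambda>h \<in> carrier G. f (inv\<^bsub>G\<^esub> g \<otimes>\<^bsub>G\<^esub> h))"

lemma group_semidirect_product:
  assumes "group N" "group H"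
    and cl: "\<And>h n. h \<in> carrier H \<Longrightarrow> n \<in> carrier N \<Longrightarrow> \<alpha> h n \<in> carrier N"
    and mult: "\<And>h n n'. h \<in> carrier H \<Longrightarrow> n \<in> carrier N \<Longrightarrow> n' \<in> carrier N \<Longrightarrow>
        \<alpha> h (n \<otimes>\<^bsub>N\<^esub> n') = \<alpha> h n \<otimes>\<^bsub>N\<^esub> \<alpha> h n'"
    and one: "\<And>n. n \<in> carrier N \<Longrightarrow> \<alpha> \<one>\<^bsub>H\<^esub> n = n"
    and comp: "\<And>h h' n. h \<in> carrier H \<Longrightarrow> h' \<in> carrier H \<Longrightarrow> n \<in> carrier N \<Longrightarrow>
        \<alpha> (h \<otimes>\<^bsub>H\<^esub> h') n = \<alpha> h (\<alpha> h' n)"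
  shows "group (semidirect_product N H \<alpha>)"
proof -
  interpret N: group N by fact
  interpret H: group H by fact
  show ?thesis
  proof (rule groupI)
    show "\<exists>y\<in>carrier (semidirect_product N H \<alpha>). y \<otimes>\<^bsub>semidirect_product N H \<alpha>\<^esub> x
        = \<one>\<^bsub>semidirect_product N H \<alpha>\<^esub>"
      if x: "x \<in> carrier (semidirect_product N H \<alpha>)" for x
    proof -
      obtain n h where nh: "x = (n, h)" "n \<in> carrier N" "h \<in> carrier H"
        using x by (auto simp: semidirect_product_def)
      then show ?thesis
        by (intro bexI[of _ "(\<alpha> (inv\<^bsub>H\<^esub> h) (inv\<^bsub>N\<^esub> n), inv\<^bsub>H\<^esub> h)"])
          (auto simp: semidirect_product_def cl H.l_inv simp flip: mult,
           metis H.inv_closed H.one_closed N.l_cancel_one' N.one_closed N.r_one cl mult)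
    qed
  qed (auto simp: semidirect_product_def cl mult one comp N.m_assoc H.m_assoc)
qed

lemma group_wreath_product:
  assumes "group A" "group G"
  shows "group (wreath_product A G)"
proof -
  interpret A: group A by fact
  interpret G: group G by fact
  let ?N = "sum_group (carrier G) (\<lambda>_. A)"
  have car: "carrier ?N = {f \<in> carrier G \<rightarrow>\<^sub>E carrier A. finite {g \<in> carrier G. f g \<noteq> \<one>\<^bsub>A\<^esub>}}"
    by (rule carrier_sum_group) (rule assms)
  show ?thesis
    unfolding wreath_product_def
  proof (rule group_semidirect_product)
    show "group ?N" using assms by simp
    show "group G" by fact
    show "(\<lambda>h\<in>carrier G. f (inv\<^bsub>G\<^esub> g \<otimes>\<^bsub>G\<^esub> h)) \<in> carrier ?N"
      if g: "g \<in> carrier G" and f: "f \<in> carrier ?N" for g f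
    proof -
      have "{h \<in> carrier G. f (inv\<^bsub>G\<^esub> g \<otimes>\<^bsub>G\<^esub> h) \<noteq> \<one>\<^bsub>A\<^esub>}
          \<subseteq> (\<lambda>h. g \<otimes>\<^bsub>G\<^esub> h) ` {h \<in> carrier G. f h \<noteq> \<one>\<^bsub>A\<^esub>}"
      proof
        fix h assume h: "h \<in> {h \<in> carrier G. f (inv\<^bsub>G\<^esub> g \<otimes>\<^bsub>G\<^esub> h) \<noteq> \<one>\<^bsub>A\<^esub>}"
        then have "h = g \<otimes>\<^bsub>G\<^esub> (inv\<^bsub>G\<^esub> g \<otimes>\<^bsub>G\<^esub> h)"
          using g by (simp flip: G.m_assoc)
        then show "h \<in> (\<lambda>h. g \<otimes>\<^bsub>G\<^esub> h) ` {h \<in> carrier G. f h \<noteq> \<one>\<^bsub>A\<^esub>}"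
          using g h by blast
      qed
      then have "finite {h \<in> carrier G. f (inv\<^bsub>G\<^esub> g \<otimes>\<^bsub>G\<^esub> h) \<noteq> \<one>\<^bsub>A\<^esub>}"
        using f finite_surj unfolding car by blast
      then show ?thesis
        using f g by (auto simp: car PiE_iff cong: conj_cong)
    qed
  qed (auto simp: car PiE_iff G.inv_mult_group G.m_assoc extensional_def fun_eq_iff)
qed

end

theory Submission
  imports Defs
begin

text \<open>Fix \<open>\<theta> : \<Sigma>\<^sup>\<int> \<rightarrow> Hom(A, B)\<close> that witnesses the lack of cancellation and a faithful action of
  \<open>G\<close> on a full shift \<open>T\<^sup>\<int>\<close>.  On \<open>(\<Sigma> \<times> B \<times> T)\<^sup>\<int>\<close> let \<open>G\<close> act on the first and third tracks and
  let \<open>a \<in> A\<close> add \<open>\<theta>(\<sigma>\<^sup>i x)(a)\<close> to the \<open>i\<close>-th symbol of the second track, where \<open>x\<close> is the first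
  track.  Conjugating by \<open>G\<close>, the finitely supported map \<open>f\<close> adds
  \<open>\<Sum>\<^sub>h \<theta>(h\<^sup>-\<^sup>1 \<sigma>\<^sup>i x)(f(h))\<close>.  All these maps commute, so the wreath product acts, and a nonzero \<open>f\<close>
  acting trivially would be an \<open>A\<close>-cancellation up to replacing \<open>h\<close> by \<open>h\<^sup>-\<^sup>1\<close>.\<close>

section \<open>Finitely supported products and maps into discrete spaces\<close>

text \<open>\<open>k\<close> restricts to a bijection between the supports, so either both are
  finite and ordinary reindexing applies, or both are infinite and both sides take the default value
  \<open>\<one>\<close>.\<close>

lemma (in comm_monoid) gfinprod_reindex:
  assumes k: "bij_betw k I J" and f: "f \<in> J \<rightarrow> carrier G"
  shows "gfinprod G (\<lambda>i. f (k i)) I = gfinprod G f J"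
proof -
  let ?s = "{i \<in> I. f (k i) \<noteq> \<one>}" and ?t = "{j \<in> J. f j \<noteq> \<one>}"
  have st: "k ` ?s = ?t" using k by (auto simp: bij_betw_def)
  have inj: "inj_on k ?s" using k by (auto simp: bij_betw_def intro: inj_on_subset)
  have "finite ?s \<longleftrightarrow> finite ?t"
    using finite_image_iff[OF inj] st by simp
  moreover have "finprod G f (k ` ?s) = finprod G (\<lambda>i. f (k i)) ?s"
    by (rule finprod_reindex) (use f inj st in auto)
  ultimately show ?thesis by (simp add: gfinprod_def st)
qed

text \<open>The product of two discrete spaces is discrete, so the pair of \<open>u\<close> and
  \<open>v\<close> is continuous into a space on which any operation \<open>p\<close> is
  continuous.\<close>

lemma continuous_map_discrete_op:
  assumes "continuous_map X (discrete_topology S) u" "continuous_map X (discrete_topology T) v"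
    and "\<And>a b. a \<in> S \<Longrightarrow> b \<in> T \<Longrightarrow> p a b \<in> U"
  shows "continuous_map X (discrete_topology U) (\<lambda>x. p (u x) (v x))"
proof -
  have "continuous_map X (discrete_topology (S \<times> T)) (\<lambda>x. (u x, v x))"
    using assms by (simp add: prod_topology_discrete_topology continuous_map_pairwise o_def)
  moreover have "continuous_map (discrete_topology (S \<times> T)) (discrete_topology U) (\<lambda>(a, b). p a b)"
    using assms(3) by auto
  ultimately show ?thesis
    using continuous_map_compose[of X _ "\<lambda>x. (u x, v x)" _ "\<lambda>(a, b). p a b"] by (simp add: o_def)
qed

lemma continuous_map_discrete_comp:
  assumes "continuous_map X (discrete_topology S) u" "\<And>a. a \<in> S \<Longrightarrow> p a \<in> U"
  shows "continuous_map X (discrete_topology U) (\<lambda>x. p (u x))"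
  using continuous_map_discrete_op[OF assms(1,1), of "\<lambda>a _. p a"] assms(2) by simp

lemma (in comm_monoid) continuous_map_finprod_discrete:
  assumes "finite I" "\<And>i. i \<in> I \<Longrightarrow> continuous_map X (discrete_topology (carrier G)) (u i)"
  shows "continuous_map X (discrete_topology (carrier G)) (\<lambda>x. finprod G (\<lambda>i. u i x) I)"
  using assms
proof (induction I rule: finite_induct)
  case (insert i I)
  have "continuous_map X (discrete_topology (carrier G)) (\<lambda>x. u i x \<otimes> finprod G (\<lambda>i. u i x) I)"
    by (rule continuous_map_discrete_op[where p = "\<lambda>a b. a \<otimes> b"]) (use insert in auto)
  \<comment> \<open>\<open>finprod_insert\<close> needs factors in the carrier, which continuity
    provides only at points of \<open>topspace X\<close>.\<close>
  moreover have "u i x \<otimes> finprod G (\<lambda>i. u i x) I = finprod G (\<lambda>i. u i x) (insert i I)"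
    if "x \<in> topspace X" for x
    using insert that continuous_map_funspace
    by (subst finprod_insert) (fastforce simp: Pi_iff)+
  ultimately show ?case by (rule continuous_map_eq)
qed simp


section \<open>Groups of shift automorphisms\<close>

lemma continuous_map_into_full_shift:
  "continuous_map X (full_shift S) f \<longleftrightarrow>
     (\<forall>i. continuous_map X (discrete_topology S) (\<lambda>x. f x i))"
  by (simp add: full_shift_def continuous_map_componentwise_UNIV)

lemma continuous_map_full_shift_coord:
  "continuous_map (full_shift S) (discrete_topology S) (\<lambda>x. x i)"
  unfolding full_shift_def by (rule continuous_map_product_projection) simp

lemma continuous_map_relabel:
  assumes "\<And>s. s \<in> S \<Longrightarrow> e s \<in> T"
  shows "continuous_map (full_shift S) (full_shift T) (\<lambda>x i. e (x i))"
  unfolding continuous_map_into_full_shift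
  using assms by (intro allI continuous_map_discrete_comp[OF continuous_map_full_shift_coord])

lemma shift_autD:
  assumes "f \<in> carrier (shift_aut S)"
  shows "continuous_map (full_shift S) (full_shift S) f"
    and "x \<in> topspace (full_shift S) \<Longrightarrow> f (shift x) = shift (f x)"
    and "f \<in> extensional (topspace (full_shift S))"
  using assms
  by (auto simp: shift_aut_def homeo_group_def homeomorphic_imp_continuous_map Bij_imp_extensional)

lemma shift_aut_mult:
  assumes "f \<in> carrier (shift_aut S)" "g \<in> carrier (shift_aut S)"
  shows "f \<otimes>\<^bsub>shift_aut S\<^esub> g = compose (topspace (full_shift S)) f g"
  using assms by (simp add: shift_aut_def homeo_group_def BijGroup_def)

lemma shift_aut_one: "\<one>\<^bsub>shift_aut S\<^esub> = (\<lambda>x\<in>topspace (full_shift S). x)"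
  by (simp add: shift_aut_def homeo_group_def BijGroup_def)

text \<open>Commuting with the shift extends to all of its powers. The action on
  \<open>\<rho>\<close>-images needs this because the cocycle is read at every translate of the
  first track.\<close>

lemma shift_aut_translate:
  assumes f: "f \<in> carrier (shift_aut S)" and x: "x \<in> topspace (full_shift S)"
  shows "f (\<lambda>j. x (j + i)) = (\<lambda>j. f x (j + i))"
proof -
  have top: "(\<lambda>j. x (j + i)) \<in> topspace (full_shift S)" for i
    using x by (simp add: topspace_full_shift)
  have step: "f (\<lambda>j. x (j + (i + 1))) = shift (f (\<lambda>j. x (j + i)))" for i
    using shift_autD(2)[OF f top[of i]] by (simp add: shift_def algebra_simps)
  show ?thesis
  proof (induction i rule: int_induct[where k = 0])
    case (step1 i)
    have "f (\<lambda>j. x (j + (i + 1))) = shift (\<lambda>j. f x (j + i))"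
      unfolding step step1 ..
    then show ?case by (simp add: shift_def ac_simps)
  next
    case (step2 i)
    have "shift (f (\<lambda>j. x (j + (i - 1)))) = (\<lambda>j. f x (j + i))"
      using step[of "i - 1"] step2 by simp
    \<comment> \<open>For negative powers the shift has to be undone: evaluating both sides at
      \<open>j - 1\<close> does so.\<close>
    then have "f (\<lambda>j. x (j + (i - 1))) (j - 1 + 1) = f x (j - 1 + i)" for j
      unfolding shift_def by (rule fun_cong)
    then show ?case by (simp add: algebra_simps fun_eq_iff)
  qed simp
qed

lemma hom_shift_autD:
  assumes "group K" "\<rho> \<in> hom K (shift_aut S)" "x \<in> topspace (full_shift S)"
  shows "k \<in> carrier K \<Longrightarrow> \<rho> k x \<in> topspace (full_shift S)"
    and "k \<in> carrier K \<Longrightarrow> l \<in> carrier K \<Longrightarrow> \<rho> (k \<otimes>\<^bsub>K\<^esub> l) x = \<rho> k (\<rho> l x)"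
    and "\<rho> \<one>\<^bsub>K\<^esub> x = x"
proof -
  have c: "\<rho> k \<in> carrier (shift_aut S)" if "k \<in> carrier K" for k
    using assms(2) that by (rule hom_in_carrier)
  show "k \<in> carrier K \<Longrightarrow> \<rho> k x \<in> topspace (full_shift S)"
    using continuous_map_funspace[OF shift_autD(1)[OF c]] assms(3) by auto
  show "k \<in> carrier K \<Longrightarrow> l \<in> carrier K \<Longrightarrow> \<rho> (k \<otimes>\<^bsub>K\<^esub> l) x = \<rho> k (\<rho> l x)"
    using assms(3) by (simp add: hom_mult[OF assms(2)] shift_aut_mult c compose_def)
  have "\<rho> \<one>\<^bsub>K\<^esub> = \<one>\<^bsub>shift_aut S\<^esub>"
    using assms by (intro hom_one group_shift_aut)
  then show "\<rho> \<one>\<^bsub>K\<^esub> x = x" using assms(3) by (simp add: shift_aut_one)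
qed

text \<open>By the action laws, \<open>\<rho>\<close> of the inverse of \<open>k\<close> inverts
  \<open>\<rho> k\<close>, so continuity of all these maps already makes them homeomorphisms. They
  are restricted because the carrier of \<open>shift_aut\<close> consists of extensional
  maps.\<close>

lemma restrict_in_hom_shift_aut:
  fixes S :: "'s set"
  defines "X \<equiv> full_shift S"
  assumes "group K"
    and cont: "\<And>k. k \<in> carrier K \<Longrightarrow> continuous_map X X (\<rho> k)"
    and mult: "\<And>k l x. k \<in> carrier K \<Longrightarrow> l \<in> carrier K \<Longrightarrow> x \<in> topspace X \<Longrightarrow>
      \<rho> (k \<otimes>\<^bsub>K\<^esub> l) x = \<rho> k (\<rho> l x)"
    and one: "\<And>x. x \<in> topspace X \<Longrightarrow> \<rho> \<one>\<^bsub>K\<^esub> x = x"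
    and shift: "\<And>k x. k \<in> carrier K \<Longrightarrow> x \<in> topspace X \<Longrightarrow> \<rho> k (shift x) = shift (\<rho> k x)"
  shows "(\<lambda>k. restrict (\<rho> k) (topspace X)) \<in> hom K (shift_aut S)"
proof -
  interpret K: group K by fact
  let ?r = "\<lambda>k. restrict (\<rho> k) (topspace X)"
  have cl: "\<rho> k x \<in> topspace X" if "k \<in> carrier K" "x \<in> topspace X" for k x
    using continuous_map_funspace[OF cont] that by auto
  have inv: "\<rho> (inv\<^bsub>K\<^esub> k) (\<rho> k x) = x" "\<rho> k (\<rho> (inv\<^bsub>K\<^esub> k) x) = x"
    if "k \<in> carrier K" "x \<in> topspace X" for k x
    using that mult[of "inv\<^bsub>K\<^esub> k" k x] mult[of k "inv\<^bsub>K\<^esub> k" x] one by auto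
  have car: "?r k \<in> carrier (shift_aut S)" if k: "k \<in> carrier K" for k
  proof -
    have "bij_betw (\<rho> k) (topspace X) (topspace X)"
      by (rule bij_betw_byWitness[where f' = "\<rho> (inv\<^bsub>K\<^esub> k)"]) (use k cl inv in auto)
    then have "?r k \<in> Bij (topspace X)"
      by (simp add: Bij_def bij_betw_cong[of _ "?r k" "\<rho> k"])
    moreover have "homeomorphic_map X X (\<rho> k)"
      unfolding homeomorphic_map_maps homeomorphic_maps_def
      using k cont inv by (intro exI[of _ "\<rho> (inv\<^bsub>K\<^esub> k)"]) auto
    then have "homeomorphic_map X X (?r k)"
      by (rule homeomorphic_map_eq) simp
    moreover have "shift x \<in> topspace X" if "x \<in> topspace X" for x
      using that by (simp add: X_def topspace_full_shift shift_def)
    ultimately show ?thesis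
      using k shift by (simp add: shift_aut_def homeo_group_def X_def)
  qed
  show ?thesis
  proof (rule homI)
    show "?r (k \<otimes>\<^bsub>K\<^esub> l) = ?r k \<otimes>\<^bsub>shift_aut S\<^esub> ?r l"
      if "k \<in> carrier K" "l \<in> carrier K" for k l
      using that car mult cl by (auto simp: shift_aut_mult compose_def fun_eq_iff X_def)
  qed (rule car)
qed

text \<open>Letters may have any type here, which admits a product alphabet. As
  \<open>class_G\<close> asks for letters in \<open>nat\<close>, the action is conjugated by an
  injective relabelling of letters; faithfulness turns it into an embedding.\<close>

lemma class_GI:
  fixes S :: "'s set"
  defines "X \<equiv> full_shift S"
  assumes K: "group K" and S: "alphabet S"
    and cont: "\<And>k. k \<in> carrier K \<Longrightarrow> continuous_map X X (\<rho> k)"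
    and mult: "\<And>k l x. k \<in> carrier K \<Longrightarrow> l \<in> carrier K \<Longrightarrow> x \<in> topspace X \<Longrightarrow>
      \<rho> (k \<otimes>\<^bsub>K\<^esub> l) x = \<rho> k (\<rho> l x)"
    and one: "\<And>x. x \<in> topspace X \<Longrightarrow> \<rho> \<one>\<^bsub>K\<^esub> x = x"
    and shift: "\<And>k x. k \<in> carrier K \<Longrightarrow> x \<in> topspace X \<Longrightarrow> \<rho> k (shift x) = shift (\<rho> k x)"
    and faithful: "\<And>k. k \<in> carrier K \<Longrightarrow> (\<And>x. x \<in> topspace X \<Longrightarrow> \<rho> k x = x) \<Longrightarrow> k = \<one>\<^bsub>K\<^esub>"
  shows "class_G K"
proof -
  obtain e :: "'s \<Rightarrow> nat" where e: "inj_on e S"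
    using finite_imp_inj_to_nat_seg S unfolding alphabet_def by blast
  define T where "T = e ` S"
  define d where "d = inv_into S e"
  define Y where "Y = full_shift T"
  define \<rho>' where "\<rho>' k y = (\<lambda>i. e (\<rho> k (\<lambda>i. d (y i)) i))" for k y
  have de: "d (e s) = s" if "s \<in> S" for s using that e by (simp add: d_def)
  have ed: "e (d t) = t" and dS: "d t \<in> S" if "t \<in> T" for t
    using that by (auto simp: d_def T_def f_inv_into_f inv_into_into)
  have X: "x \<in> topspace X \<longleftrightarrow> (\<forall>i. x i \<in> S)" for x by (simp add: X_def topspace_full_shift)
  have Y: "y \<in> topspace Y \<longleftrightarrow> (\<forall>i. y i \<in> T)" for y by (simp add: Y_def topspace_full_shift)
  have cl: "\<rho> k x i \<in> S" if "k \<in> carrier K" "x \<in> topspace X" for k x i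
    using continuous_map_funspace[OF cont[OF that(1)]] that(2) X by auto
  have "continuous_map Y Y (\<rho>' k)" if "k \<in> carrier K" for k
  proof -
    have "continuous_map Y X (\<lambda>y i. d (y i))" "continuous_map X Y (\<lambda>x i. e (x i))"
      unfolding X_def Y_def by (rule continuous_map_relabel; simp add: dS T_def)+
    from continuous_map_compose[OF continuous_map_compose[OF this(1) cont[OF that]] this(2)]
    show ?thesis by (simp add: o_def \<rho>'_def[abs_def])
  qed
  moreover have "\<rho>' (k \<otimes>\<^bsub>K\<^esub> l) y = \<rho>' k (\<rho>' l y)"
    if "k \<in> carrier K" "l \<in> carrier K" "y \<in> topspace Y" for k l y
    using that by (simp add: \<rho>'_def mult X Y dS de cl)
  moreover have "\<rho>' \<one>\<^bsub>K\<^esub> y = y" if "y \<in> topspace Y" for y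
    using that by (simp add: \<rho>'_def one X Y dS ed)
  moreover have "\<rho>' k (shift y) = shift (\<rho>' k y)" if "k \<in> carrier K" "y \<in> topspace Y" for k y
    using that shift[of k "\<lambda>i. d (y i)"] by (simp add: \<rho>'_def X Y dS shift_def)
  ultimately have hom: "(\<lambda>k. restrict (\<rho>' k) (topspace Y)) \<in> hom K (shift_aut T)"
    using K unfolding Y_def by (intro restrict_in_hom_shift_aut)
  let ?r = "\<lambda>k. restrict (\<rho>' k) (topspace Y)"
  interpret r: group_hom K "shift_aut T" ?r
    using K hom group_shift_aut by (simp add: group_hom_def group_hom_axioms_def)
  have "k = \<one>\<^bsub>K\<^esub>" if k: "k \<in> carrier K" and r: "?r k = \<one>\<^bsub>shift_aut T\<^esub>" for k
  proof (rule faithful[OF k])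
    fix x assume x: "x \<in> topspace X"
    \<comment> \<open>On this relabelled point \<open>\<rho>'\<close> shows what
      \<open>\<rho>\<close> does at \<open>x\<close>, since \<open>d\<close> undoes \<open>e\<close>
      on \<open>S\<close>.\<close>
    let ?y = "\<lambda>i. e (x i)"
    have y: "?y \<in> topspace Y" using x by (simp add: X Y T_def)
    have "\<rho>' k ?y = ?y" using fun_cong[OF r, of ?y] y by (simp add: shift_aut_one Y_def)
    then have "e (\<rho> k x i) = e (x i)" for i
      using x by (simp add: \<rho>'_def de X fun_eq_iff)
    then show "\<rho> k x = x"
      using de cl[OF k x] x by (metis X ext)
  qed
  then have inj: "inj_on ?r (carrier K)" unfolding r.inj_on_one_iff by blast
  have "K \<cong> shift_aut T\<lparr>carrier := ?r ` carrier K\<rparr>"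
    using hom inj by (intro is_isoI[of ?r]) (auto simp: iso_def hom_def bij_betw_def)
  moreover have "alphabet T"
    using S e by (simp add: alphabet_def T_def card_image)
  ultimately show ?thesis
    unfolding class_G_def using K r.img_is_subgroup by blast
qed

lemma class_G_obtain:
  assumes "class_G G"
  obtains S :: "nat set" and \<psi> where "alphabet S" "\<psi> \<in> hom G (shift_aut S)" "inj_on \<psi> (carrier G)"
proof -
  obtain S :: "nat set" and H \<psi> where "alphabet S" "subgroup H (shift_aut S)"
      "\<psi> \<in> iso G (shift_aut S\<lparr>carrier := H\<rparr>)"
    using assms by (auto simp: class_G_def is_iso_def)
  then have "\<psi> \<in> hom G (shift_aut S)" "inj_on \<psi> (carrier G)"
    by (auto simp: iso_def hom_def bij_betw_def Pi_iff dest: subgroup.mem_carrier)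
  with \<open>alphabet S\<close> show thesis by (rule that)
qed


section \<open>The cocycle of the wreath product\<close>

text \<open>The inverse turns left translation of \<open>f\<close> into the action on points, as
  \<open>cocycle_equivariant\<close> makes precise. \<open>gfinprod\<close> allows \<open>G\<close>
  to be infinite.\<close>

definition wreath_cocycle ::
  "('g, 'n) monoid_scheme \<Rightarrow> ('b, 'k) monoid_scheme \<Rightarrow> ('g \<Rightarrow> 'x \<Rightarrow> 'x) \<Rightarrow> ('x \<Rightarrow> 'a \<Rightarrow> 'b) \<Rightarrow>
   ('g \<Rightarrow> 'a) \<Rightarrow> 'x \<Rightarrow> 'b" where
  "wreath_cocycle G B \<phi> \<theta> f x = gfinprod B (\<lambda>h. \<theta> (\<phi> (inv\<^bsub>G\<^esub> h) x) (f h)) (carrier G)"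

text \<open>The algebra of the cocycle concerns the \<open>G\<close>-action only, so
  \<open>X\<close> is an arbitrary system here; the shift enters in the final theorem.\<close>

locale system_cocycle = A: comm_group A + B: comm_group B
  for A :: "('a, 'm) monoid_scheme" and B :: "('b, 'k) monoid_scheme" +
  fixes G :: "('g, 'n) monoid_scheme" and X :: "'x topology"
    and \<phi> :: "'g \<Rightarrow> 'x \<Rightarrow> 'x" and \<theta> :: "'x \<Rightarrow> 'a \<Rightarrow> 'b"
  assumes system: "G_system G X \<phi>"
    and continuous: "continuous_map X (discrete_topology (Hom A B)) \<theta>"
begin

sublocale G: group G using system by (simp add: G_system_def)

abbreviation N where "N \<equiv> sum_group (carrier G) (\<lambda>_. A)"

abbreviation c where "c \<equiv> wreath_cocycle G B \<phi> \<theta>"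

lemma carrier_N:
  "carrier N = {f \<in> carrier G \<rightarrow>\<^sub>E carrier A. finite {g \<in> carrier G. f g \<noteq> \<one>\<^bsub>A\<^esub>}}"
  by (simp add: carrier_sum_group)

text \<open>The translate is the factor that \<open>g\<close> produces in a wreath product
  multiplication. Its support is the preimage of the support of \<open>f\<close> under an injective
  map, hence finite.\<close>

lemma translate_closed:
  assumes f: "f \<in> carrier N" and g: "g \<in> carrier G"
  shows "(\<lambda>h\<in>carrier G. f (inv\<^bsub>G\<^esub> g \<otimes>\<^bsub>G\<^esub> h)) \<in> carrier N"
proof -
  have inj: "inj_on (\<lambda>h. inv\<^bsub>G\<^esub> g \<otimes>\<^bsub>G\<^esub> h) (carrier G)"
    using g by (simp add: inj_on_def)
  have "finite ((\<lambda>h. inv\<^bsub>G\<^esub> g \<otimes>\<^bsub>G\<^esub> h) -` {h \<in> carrier G. f h \<noteq> \<one>\<^bsub>A\<^esub>} \<inter> carrier G)"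
    using f by (intro finite_vimage_IntI inj) (simp add: carrier_N)
  then have "finite {h \<in> carrier G. f (inv\<^bsub>G\<^esub> g \<otimes>\<^bsub>G\<^esub> h) \<noteq> \<one>\<^bsub>A\<^esub>}"
    by (rule rev_finite_subset) (use g in auto)
  then show ?thesis
    using f g by (auto simp: carrier_N PiE_iff cong: conj_cong)
qed

lemma action_continuous: "g \<in> carrier G \<Longrightarrow> continuous_map X X (\<phi> g)"
  using system
  by (auto simp: G_system_def homeo_group_def hom_def intro!: homeomorphic_imp_continuous_map)

lemma action_closed: "g \<in> carrier G \<Longrightarrow> x \<in> topspace X \<Longrightarrow> \<phi> g x \<in> topspace X"
  using continuous_map_funspace[OF action_continuous] by auto

lemma action_mult:
  assumes "g \<in> carrier G" "h \<in> carrier G" "x \<in> topspace X"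
  shows "\<phi> (g \<otimes>\<^bsub>G\<^esub> h) x = \<phi> g (\<phi> h x)"
proof -
  have "\<phi> \<in> hom G (homeo_group X)" using system by (simp add: G_system_def)
  moreover from this have "\<phi> g \<in> carrier (homeo_group X)" "\<phi> h \<in> carrier (homeo_group X)"
    using assms by (auto intro: hom_in_carrier)
  ultimately show ?thesis
    using assms by (simp add: hom_mult homeo_group_def BijGroup_def compose_def)
qed

lemma theta_hom: "x \<in> topspace X \<Longrightarrow> \<theta> x \<in> hom A B"
  using continuous_map_funspace[OF continuous] by (auto simp: Hom_def)

lemma theta_closed:
  "f \<in> carrier N \<Longrightarrow> g \<in> carrier G \<Longrightarrow> h \<in> carrier G \<Longrightarrow> x \<in> topspace X \<Longrightarrow>
     \<theta> (\<phi> g x) (f h) \<in> carrier B"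
  using hom_in_carrier[OF theta_hom[OF action_closed]] by (auto simp: carrier_N)

text \<open>Each factor is a homomorphism in the value \<open>f h\<close>, and homomorphisms on the
  summands combine on the direct sum because \<open>B\<close> is commutative.\<close>

lemma cocycle_hom: "x \<in> topspace X \<Longrightarrow> (\<lambda>f. c f x) \<in> hom N B"
  unfolding wreath_cocycle_def
  by (rule B.hom_group_sum) (auto intro: theta_hom action_closed)

lemma cocycle_closed: "f \<in> carrier N \<Longrightarrow> x \<in> topspace X \<Longrightarrow> c f x \<in> carrier B"
  using hom_in_carrier[OF cocycle_hom] .

text \<open>Only the finite support of \<open>f\<close> contributes, uniformly in \<open>x\<close>,
  which leaves a finite product of continuous maps into a discrete group.\<close>

lemma cocycle_continuous:
  assumes f: "f \<in> carrier N"
  shows "continuous_map X (discrete_topology (carrier B)) (c f)"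
proof -
  let ?s = "{h \<in> carrier G. f h \<noteq> \<one>\<^bsub>A\<^esub>}"
  have fin: "finite ?s" using f by (simp add: carrier_N)
  have "c f x = finprod B (\<lambda>h. \<theta> (\<phi> (inv\<^bsub>G\<^esub> h) x) (f h)) ?s" if x: "x \<in> topspace X" for x
  proof -
    \<comment> \<open>The support of the factors may vary with \<open>x\<close>, but it lies in
      \<open>?s\<close> because \<open>\<theta>\<close> takes homomorphisms as values.\<close>
    have "c f x = gfinprod B (\<lambda>h. \<theta> (\<phi> (inv\<^bsub>G\<^esub> h) x) (f h)) ?s"
      unfolding wreath_cocycle_def
      using f x hom_one[OF theta_hom[OF action_closed] A.is_group B.is_group]
      by (intro B.gfinprod_mono_neutral_cong_right) (auto intro: theta_closed)
    then show ?thesis using fin f x by (simp add: theta_closed Pi_iff)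
  qed
  moreover have "continuous_map X (discrete_topology (carrier B))
      (\<lambda>x. finprod B (\<lambda>h. \<theta> (\<phi> (inv\<^bsub>G\<^esub> h) x) (f h)) ?s)"
  proof (rule B.continuous_map_finprod_discrete[OF fin])
    fix h assume h: "h \<in> ?s"
    have "continuous_map X (discrete_topology (Hom A B)) (\<lambda>x. \<theta> (\<phi> (inv\<^bsub>G\<^esub> h) x))"
      using continuous_map_compose[OF action_continuous continuous] h by (simp add: o_def)
    then show "continuous_map X (discrete_topology (carrier B))
        (\<lambda>x. \<theta> (\<phi> (inv\<^bsub>G\<^esub> h) x) (f h))"
      by (rule continuous_map_discrete_comp) (use f h in \<open>auto simp: Hom_def carrier_N hom_def\<close>)
  qed
  ultimately show ?thesis by (metis (no_types, lifting) continuous_map_eq)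
qed

text \<open>Substitute the product of the inverse of \<open>g\<close> with \<open>h\<close> for
  \<open>h\<close>: its inverse is the inverse of \<open>h\<close> times \<open>g\<close>, which
  acts on \<open>x\<close> as the inverse of \<open>h\<close> acts on
  \<open>\<phi> g x\<close>.\<close>

lemma cocycle_equivariant:
  assumes f: "f \<in> carrier N" and g: "g \<in> carrier G" and x: "x \<in> topspace X"
  shows "c (\<lambda>h\<in>carrier G. f (inv\<^bsub>G\<^esub> g \<otimes>\<^bsub>G\<^esub> h)) (\<phi> g x) = c f x"
proof -
  let ?F = "\<lambda>h. \<theta> (\<phi> (inv\<^bsub>G\<^esub> h) x) (f h)"
  have "bij_betw (\<lambda>h. inv\<^bsub>G\<^esub> g \<otimes>\<^bsub>G\<^esub> h) (carrier G) (carrier G)"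
    by (rule bij_betw_byWitness[where f' = "\<lambda>h. g \<otimes>\<^bsub>G\<^esub> h"])
      (use g in \<open>auto simp flip: G.m_assoc\<close>)
  moreover have F: "?F \<in> carrier G \<rightarrow> carrier B"
    using f x by (auto intro: theta_closed)
  ultimately have "c f x = gfinprod B (\<lambda>h. ?F (inv\<^bsub>G\<^esub> g \<otimes>\<^bsub>G\<^esub> h)) (carrier G)"
    unfolding wreath_cocycle_def by (rule B.gfinprod_reindex[symmetric])
  also have "\<dots> = c (\<lambda>h\<in>carrier G. f (inv\<^bsub>G\<^esub> g \<otimes>\<^bsub>G\<^esub> h)) (\<phi> g x)"
    unfolding wreath_cocycle_def
    using f g x
    by (intro B.gfinprod_cong)
      (auto intro!: theta_closed simp: simp_implies_def G.inv_mult_group simp flip: action_mult)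
  finally show ?thesis by simp
qed

text \<open>Precomposing \<open>f\<close> with inversion turns its cocycle into the product in
  \<open>has_cancellation_wrt\<close>. A trivial cocycle thus yields a cancellation unless the
  inverted map \<open>f'\<close> is trivial, and then so is \<open>f\<close>.\<close>

lemma cocycle_trivial_imp_one:
  assumes nc: "\<not> has_cancellation_wrt A G X \<phi> \<theta> B"
    and f: "f \<in> carrier N" and triv: "\<And>x. x \<in> topspace X \<Longrightarrow> c f x = \<one>\<^bsub>B\<^esub>"
  shows "f = \<one>\<^bsub>N\<^esub>"
proof -
  define f' where "f' = (\<lambda>h\<in>carrier G. f (inv\<^bsub>G\<^esub> h))"
  have bij: "bij_betw (\<lambda>h. inv\<^bsub>G\<^esub> h) (carrier G) (carrier G)"
    by (rule bij_betw_byWitness[where f' = "\<lambda>h. inv\<^bsub>G\<^esub> h"]) auto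
  have supp: "{h \<in> carrier G. f' h \<noteq> \<one>\<^bsub>A\<^esub>} \<subseteq> (\<lambda>h. inv\<^bsub>G\<^esub> h) ` {h \<in> carrier G. f h \<noteq> \<one>\<^bsub>A\<^esub>}"
  proof
    fix h assume "h \<in> {h \<in> carrier G. f' h \<noteq> \<one>\<^bsub>A\<^esub>}"
    then have "h = inv\<^bsub>G\<^esub> (inv\<^bsub>G\<^esub> h)" "inv\<^bsub>G\<^esub> h \<in> {h \<in> carrier G. f h \<noteq> \<one>\<^bsub>A\<^esub>}"
      by (auto simp: f'_def)
    then show "h \<in> (\<lambda>h. inv\<^bsub>G\<^esub> h) ` {h \<in> carrier G. f h \<noteq> \<one>\<^bsub>A\<^esub>}" by (rule image_eqI)
  qed
  have "finite {h \<in> carrier G. f h \<noteq> \<one>\<^bsub>A\<^esub>}" using f by (simp add: carrier_N)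
  from finite_surj[OF this supp] have f': "f' \<in> carrier N"
    using f by (auto simp: carrier_N f'_def PiE_iff)
  have "gfinprod B (\<lambda>g. \<theta> (\<phi> g x) (f' g)) (carrier G) = \<one>\<^bsub>B\<^esub>" if x: "x \<in> topspace X" for x
  proof -
    have "gfinprod B (\<lambda>g. \<theta> (\<phi> g x) (f' g)) (carrier G)
        = gfinprod B (\<lambda>h. \<theta> (\<phi> (inv\<^bsub>G\<^esub> h) x) (f' (inv\<^bsub>G\<^esub> h))) (carrier G)"
      using f' x by (intro B.gfinprod_reindex[OF bij, symmetric]) (auto intro: theta_closed)
    also have "\<dots> = c f x"
      unfolding wreath_cocycle_def
      by (rule B.gfinprod_cong) (use f x in \<open>auto intro: theta_closed simp: f'_def simp_implies_def\<close>)
    finally show ?thesis using triv x by simp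
  qed
  then have "f' = \<one>\<^bsub>N\<^esub>" using nc f' unfolding has_cancellation_wrt_def by blast
  then have "f' (inv\<^bsub>G\<^esub> h) = \<one>\<^bsub>A\<^esub>" if "h \<in> carrier G" for h
    using that by simp
  then show ?thesis
    using f by (auto simp: f'_def carrier_N fun_eq_iff PiE_iff extensional_def)
qed

end


section \<open>The faithful action of the wreath product on three tracks\<close>

theorem theorem2:
  fixes A :: "'a monoid" and G :: "'g monoid" and S :: "'s set"
    and \<phi> :: "'g \<Rightarrow> (int \<Rightarrow> 's) \<Rightarrow> (int \<Rightarrow> 's)"
  assumes "comm_group A" and "finite (carrier A)"
    and "class_G G"
    and "alphabet S"
    and "\<phi> \<in> hom G (shift_aut S)"
    and "\<not> has_cancellation A G (full_shift S) \<phi>"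
  shows "class_G (wreath_product A G)"
proof -
  have G: "group G" using assms(3) by (simp add: class_G_def)
  obtain B :: "nat monoid" and \<theta> where B: "comm_group B" "finite (carrier B)"
    and \<theta>: "continuous_map (full_shift S) (discrete_topology (Hom A B)) \<theta>"
    and nc: "\<not> has_cancellation_wrt A G (full_shift S) \<phi> \<theta> B"
    using assms(6) by (auto simp: has_cancellation_def)
  \<comment> \<open>\<open>\<phi>\<close> may have a kernel, so membership in the class supplies a
    faithful action \<open>\<psi>\<close>, possibly over another alphabet.\<close>
  obtain T :: "nat set" and \<psi> where T: "alphabet T" and \<psi>: "\<psi> \<in> hom G (shift_aut T)"
    and inj: "inj_on \<psi> (carrier G)"
    using class_G_obtain[OF assms(3)] .
  interpret system_cocycle A B G "full_shift S" \<phi> \<theta>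
    using assms(1) B(1) \<theta> G_system_shift_aut[OF G assms(4,5)]
    by (simp add: system_cocycle_def system_cocycle_axioms_def)
  interpret \<psi>: group_hom G "shift_aut T" \<psi>
    using \<psi> G group_shift_aut by (simp add: group_hom_def group_hom_axioms_def)
  let ?S = "full_shift S" and ?T = "full_shift T"
  let ?W = "wreath_product A G"
  define R where "R = S \<times> carrier B \<times> T"
  let ?R = "full_shift R"
  define tx where "tx w = (\<lambda>i::int. fst (w i))" for w :: "int \<Rightarrow> 's \<times> nat \<times> nat"
  define ty where "ty w = (\<lambda>i::int. fst (snd (w i)))" for w :: "int \<Rightarrow> 's \<times> nat \<times> nat"
  define tz where "tz w = (\<lambda>i::int. snd (snd (w i)))" for w :: "int \<Rightarrow> 's \<times> nat \<times> nat"
  \<comment> \<open>A pair \<open>(f, g)\<close> acts as \<open>g\<close> followed by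
    \<open>f\<close>, so the cocycle is evaluated on the first track already moved by
    \<open>g\<close>. The argument with index \<open>j + i\<close> is that track shifted
    \<open>i\<close> times, which makes the map commute with the shift.\<close>
  define \<rho> where "\<rho> = (\<lambda>(f, g) w i. (\<phi> g (tx w) i,
      c f (\<lambda>j. \<phi> g (tx w) (j + i)) \<otimes>\<^bsub>B\<^esub> ty w i, \<psi> g (tz w) i))"
  have carW: "carrier ?W = carrier N \<times> carrier G"
    by (simp add: wreath_product_def semidirect_product_def)
  have top: "w \<in> topspace ?R \<longleftrightarrow>
      tx w \<in> topspace ?S \<and> (\<forall>i. ty w i \<in> carrier B) \<and> tz w \<in> topspace ?T" for w
    by (auto simp: topspace_full_shift R_def tx_def ty_def tz_def mem_Times_iff)
  have tr: "(\<lambda>j. x (j + i)) \<in> topspace ?S" if "x \<in> topspace ?S" for x and i :: int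
    using that by (simp add: topspace_full_shift)
  have aut: "\<phi> g \<in> carrier (shift_aut S)" if "g \<in> carrier G" for g
    using assms(5) that by (rule hom_in_carrier)
  show ?thesis
  proof (rule class_GI[of ?W R \<rho>])
    show W: "group ?W" by (rule group_wreath_product) (rule A.is_group G)+
    \<comment> \<open>\<open>B\<close> may be trivial, but it is nonempty; the two letters required
      of \<open>R\<close> come from \<open>S\<close>.\<close>
    have "card (carrier B) \<noteq> 0" using B(2) B.one_closed by auto
    then have "1 \<le> card (carrier B) * card T" using T by (simp add: alphabet_def Suc_le_eq)
    from mult_le_mono[OF _ this, of 2 "card S"]
    have "2 \<le> card S * (card (carrier B) * card T)"
      using assms(4) by (simp add: alphabet_def)
    then show "alphabet R"
      using assms(4) T B(2) by (simp add: alphabet_def R_def card_cartesian_product)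
    show "continuous_map ?R ?R (\<rho> k)" if k: "k \<in> carrier ?W" for k
    proof -
      obtain f g where k: "k = (f, g)" "f \<in> carrier N" "g \<in> carrier G"
        using k carW by auto
      have "continuous_map ?R ?S tx" "continuous_map ?R ?T tz"
        unfolding tx_def[abs_def] tz_def[abs_def]
        by (rule continuous_map_relabel; auto simp: R_def)+
      then have x: "continuous_map ?R ?S (\<lambda>w. \<phi> g (tx w))"
        and z: "continuous_map ?R ?T (\<lambda>w. \<psi> g (tz w))"
        using continuous_map_compose[OF _ action_continuous[OF k(3)]]
          continuous_map_compose[OF _ shift_autD(1)[OF \<psi>.hom_closed[OF k(3)]]]
        by (auto simp: o_def)
      have "continuous_map ?R ?S (\<lambda>w j. \<phi> g (tx w) (j + i))" for i
        using x by (simp add: continuous_map_into_full_shift)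
      then have c: "continuous_map ?R (discrete_topology (carrier B))
          (\<lambda>w. c f (\<lambda>j. \<phi> g (tx w) (j + i)))" for i
        using continuous_map_compose[OF _ cocycle_continuous[OF k(2)]] by (auto simp: o_def)
      have ty: "continuous_map ?R (discrete_topology (carrier B)) (\<lambda>w. ty w i)" for i
        unfolding ty_def
        by (rule continuous_map_discrete_comp[OF continuous_map_full_shift_coord])
          (auto simp: R_def)
      have y: "continuous_map ?R (discrete_topology (carrier B))
          (\<lambda>w. c f (\<lambda>j. \<phi> g (tx w) (j + i)) \<otimes>\<^bsub>B\<^esub> ty w i)" for i
        by (rule continuous_map_discrete_op[OF c ty, where p = "\<lambda>a b. a \<otimes>\<^bsub>B\<^esub> b"]) simp
      show ?thesis
        unfolding continuous_map_into_full_shift[of ?R R]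
      proof
        fix i
        have "continuous_map ?R (discrete_topology S) (\<lambda>w. \<phi> g (tx w) i)"
          and "continuous_map ?R (discrete_topology T) (\<lambda>w. \<psi> g (tz w) i)"
          using x z unfolding continuous_map_into_full_shift by blast+
        with y[of i] show "continuous_map ?R (discrete_topology R) (\<lambda>w. \<rho> k w i)"
          by (simp add: \<rho>_def k(1) R_def prod_topology_discrete_topology continuous_map_pairwise
              o_def)
      qed
    qed
    show "\<rho> (k \<otimes>\<^bsub>?W\<^esub> l) w = \<rho> k (\<rho> l w)"
      if k: "k \<in> carrier ?W" and l: "l \<in> carrier ?W" and w: "w \<in> topspace ?R" for k l w
    proof -
      obtain f g where k: "k = (f, g)" "f \<in> carrier N" "g \<in> carrier G"
        using k carW by auto
      obtain f' g' where l: "l = (f', g')" "f' \<in> carrier N" "g' \<in> carrier G"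
        using l carW by auto
      define gf' where "gf' = (\<lambda>h\<in>carrier G. f' (inv\<^bsub>G\<^esub> g \<otimes>\<^bsub>G\<^esub> h))"
      have kl: "k \<otimes>\<^bsub>?W\<^esub> l = (f \<otimes>\<^bsub>N\<^esub> gf', g \<otimes>\<^bsub>G\<^esub> g')"
        by (simp add: k l wreath_product_def semidirect_product_def gf'_def)
      have gf': "gf' \<in> carrier N"
        unfolding gf'_def using l(2) k(3) by (rule translate_closed)
      have x: "tx w \<in> topspace ?S" and z: "tz w \<in> topspace ?T"
        and y: "ty w i \<in> carrier B" for i
        using w top by auto
      let ?x' = "\<phi> g' (tx w)"
      have x': "?x' \<in> topspace ?S" using x l by (simp add: action_closed)
      have gx: "\<phi> (g \<otimes>\<^bsub>G\<^esub> g') (tx w) = \<phi> g ?x'"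
        using action_mult k l x by simp
      \<comment> \<open>This is the cocycle identity behind the action law: \<open>\<rho> l\<close>
        adds the second factor at \<open>?x'\<close>, and \<open>\<rho> k\<close> then adds the
        first at \<open>\<phi> g ?x'\<close>.\<close>
      have "c (f \<otimes>\<^bsub>N\<^esub> gf') (\<lambda>j. \<phi> g ?x' (j + i))
          = c f (\<lambda>j. \<phi> g ?x' (j + i)) \<otimes>\<^bsub>B\<^esub> c f' (\<lambda>j. ?x' (j + i))" for i
      proof -
        \<comment> \<open>Equivariance is applied at the translate of \<open>?x'\<close>;
          \<open>\<phi> g\<close> commutes with the translation.\<close>
        have "c gf' (\<lambda>j. \<phi> g ?x' (j + i)) = c f' (\<lambda>j. ?x' (j + i))"
          using cocycle_equivariant[OF l(2) k(3) tr[OF x']]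
          by (simp add: gf'_def shift_aut_translate[OF aut[OF k(3)] x'])
        then show ?thesis
          using hom_mult[OF cocycle_hom[OF tr[OF action_closed[OF k(3) x']]] k(2) gf'] by simp
      qed
      moreover have "c f (\<lambda>j. \<phi> g ?x' (j + i)) \<in> carrier B" "c f' (\<lambda>j. ?x' (j + i)) \<in> carrier B" for i
        using k l x' by (auto intro!: cocycle_closed tr action_closed)
      ultimately show ?thesis
        unfolding kl using y hom_shift_autD(2)[OF G \<psi> z k(3) l(3)]
        \<comment> \<open>The projections are unfolded only on explicit triples, so that
          \<open>tx w\<close>, \<open>ty w\<close> and \<open>tz w\<close> stay folded for the facts
          about them.\<close>
        by (simp add: \<rho>_def k l gx tx_def[of "\<lambda>i. (_ i, _ i)"] ty_def[of "\<lambda>i. (_ i, _ i)"]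
            tz_def[of "\<lambda>i. (_ i, _ i)"] B.m_assoc)
    qed
    show "\<rho> \<one>\<^bsub>?W\<^esub> w = w" if w: "w \<in> topspace ?R" for w
    proof -
      have "c \<one>\<^bsub>N\<^esub> x = \<one>\<^bsub>B\<^esub>" if "x \<in> topspace ?S" for x
        using hom_one[OF cocycle_hom[OF that]] A.is_group B.is_group by simp
      moreover have "\<one>\<^bsub>?W\<^esub> = (\<one>\<^bsub>N\<^esub>, \<one>\<^bsub>G\<^esub>)"
        by (simp add: wreath_product_def semidirect_product_def)
      moreover have "\<phi> \<one>\<^bsub>G\<^esub> (tx w) = tx w" "\<psi> \<one>\<^bsub>G\<^esub> (tz w) = tz w"
        using w[unfolded top] hom_shift_autD(3)[OF G] assms(5) \<psi> by blast+
      ultimately show ?thesis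
        using w[unfolded top] tr
        \<comment> \<open>The deleted rules would rewrite the identity of \<open>N\<close> and the
          value of \<open>\<psi>\<close> at the identity before the facts above could match.\<close>
        by (simp add: \<rho>_def del: one_sum_group \<psi>.hom_one) (simp add: tx_def ty_def tz_def)
    qed
    show "\<rho> k (shift w) = shift (\<rho> k w)" if k: "k \<in> carrier ?W" and w: "w \<in> topspace ?R" for k w
    proof -
      obtain f g where k: "k = (f, g)" "f \<in> carrier N" "g \<in> carrier G"
        using k carW by auto
      have "tx (shift w) = shift (tx w)" "ty (shift w) = shift (ty w)" "tz (shift w) = shift (tz w)"
        by (simp_all add: tx_def ty_def tz_def shift_def)
      then show ?thesis
        using w[unfolded top] shift_autD(2)[OF aut[OF k(3)]]
          shift_autD(2)[OF \<psi>.hom_closed[OF k(3)]]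
        by (simp add: \<rho>_def k(1)) (simp add: shift_def algebra_simps)
    qed
    show "k = \<one>\<^bsub>?W\<^esub>" if k: "k \<in> carrier ?W" and triv: "\<And>w. w \<in> topspace ?R \<Longrightarrow> \<rho> k w = w" for k
    proof -
      obtain f g where k: "k = (f, g)" "f \<in> carrier N" "g \<in> carrier G"
        using k carW by auto
      have pointwise: "c f (\<lambda>j. \<phi> g x (j + i)) = \<one>\<^bsub>B\<^esub> \<and> \<phi> g x = x \<and> \<psi> g z = z"
        if x: "x \<in> topspace ?S" and z: "z \<in> topspace ?T" for x z i
      proof -
        \<comment> \<open>With the identity of \<open>B\<close> on the second track, the new second
          track is the cocycle itself.\<close>
        let ?w = "\<lambda>i. (x i, \<one>\<^bsub>B\<^esub>, z i)"
        have t: "tx ?w = x" "ty ?w = (\<lambda>_. \<one>\<^bsub>B\<^esub>)" "tz ?w = z"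
          by (simp_all add: tx_def ty_def tz_def)
        have "?w \<in> topspace ?R" using x z by (simp add: top t)
        have coords: "\<phi> g x i = x i \<and> c f (\<lambda>j. \<phi> g x (j + i)) \<otimes>\<^bsub>B\<^esub> \<one>\<^bsub>B\<^esub> = \<one>\<^bsub>B\<^esub> \<and> \<psi> g z i = z i" for i
          using fun_cong[OF triv[OF \<open>?w \<in> topspace ?R\<close>], of i] unfolding \<rho>_def k(1)
          by (simp only: prod.case t prod.inject)
        have "c f (\<lambda>j. \<phi> g x (j + i)) \<in> carrier B"
          using k x by (auto intro!: cocycle_closed tr action_closed)
        then have "c f (\<lambda>j. \<phi> g x (j + i)) = \<one>\<^bsub>B\<^esub>" using coords[of i] by (metis B.r_one)
        with coords show ?thesis by blast
      qed
      \<comment> \<open>Constant points fill the remaining track, so that \<open>g\<close> can be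
        tested on every \<open>z\<close> and \<open>f\<close> on every \<open>x\<close>.\<close>
      obtain s t where "s \<in> S" "t \<in> T"
        using assms(4) T by (fastforce simp: alphabet_def)
      then have x0: "(\<lambda>_. s) \<in> topspace ?S" and z0: "(\<lambda>_. t) \<in> topspace ?T"
        by (simp_all add: topspace_full_shift)
      have "\<psi> g = \<one>\<^bsub>shift_aut T\<^esub>"
        using pointwise[OF x0] shift_autD(3)[OF \<psi>.hom_closed[OF k(3)]]
        by (auto simp: shift_aut_one extensional_def fun_eq_iff)
      then have "g = \<one>\<^bsub>G\<^esub>"
        using inj k(3) \<psi>.hom_one by (metis G.one_closed inj_onD)
      moreover have "f = \<one>\<^bsub>N\<^esub>"
      proof (rule cocycle_trivial_imp_one[OF nc k(2)])
        fix x assume "x \<in> topspace ?S"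
        \<comment> \<open>At index 0, \<open>pointwise\<close> gives the cocycle at
          \<open>\<phi> g x\<close>, and also that \<open>\<phi> g x = x\<close>.\<close>
        then show "c f x = \<one>\<^bsub>B\<^esub>" using pointwise[OF _ z0, of x 0] by simp metis
      qed
      ultimately show ?thesis
        by (simp add: k(1) wreath_product_def semidirect_product_def)
    qed
  qed
qed

end
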